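(* Let $v(0)\in\mathcal N^*$ and for $n\ge1$ let $\lambda_n:[0,\infty)\to(0,\infty)$ be continuous with $\inf_t\lambda_n(t)>0$, and suppose $\lambda_n\to0$ uniformly on $[0,\infty)$. Let $v^n(t)$ be the solution of the subcritical equations with initial condition $v(0)$ and rate function $\lambda_n$, and let $v(t)$ be the solution of the critical equations with initial condition $v(0)$. Then $\lim_{n\to\infty}v^n_k(t)=v_k(t)$ for all $t\ge0$ and $k\ge1$, and $\Phi_n\to\Phi$ uniformly on $[0,\infty)$, where $\Phi_n(t)=m_0(0)-m^n_0(t)$ and $\Phi(t)=m_0(0)-m_0(t)$.
   Context: $\mathcal N$: sequences $v=(v_k)_{k\ge1}$ of nonnegative reals with $\sum_kv_k<\infty$; $\mathcal N^*$: those with finitely many nonzero terms; $m_0=\sum_kv_k$ (and $m_0(t)$, $m^n_0(t)$ for the corresponding time-dependent sequences). The subcritical equations with rate function $\lambda$ (continuous, bounded below by a positive constant): $v(t)\in\mathcal N$ and for all $k$, $v_k(t)=v_k(0)+\int_0^t\big(\tfrac k2\sum_{l=1}^{k-1}v_l(s)v_{k-l}(s)-kv_k(s)m_0(s)-\lambda(s)kv_k(s)\big)ds$, with $\Phi(t)=m_0(0)-m_0(t)$ satisfying $0\le\Phi(s)\le\Phi(t)<m_0(0)$ for $s\le t$. The critical equations are the same with $\lambda\equiv0$. Both have unique solutions. *)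

theory Defs
  imports "HOL-Analysis.Analysis"
begin

text \<open>Sequences \<open>v = (v_k)_{k\<ge>1}\<close> are represented as functions \<open>nat \<Rightarrow> real\<close>;
  only the entries with index \<open>k \<ge> 1\<close> are meaningful (entry 0 is ignored).\<close>

definition inN :: "(nat \<Rightarrow> real) \<Rightarrow> bool" where
  "inN v \<longleftrightarrow> (\<forall>k\<ge>1. v k \<ge> 0) \<and> summable (\<lambda>k. v (Suc k))"

definition inNstar :: "(nat \<Rightarrow> real) \<Rightarrow> bool" where
  "inNstar v \<longleftrightarrow> inN v \<and> finite {k. k \<ge> 1 \<and> v k \<noteq> 0}"

definition m0 :: "(nat \<Rightarrow> real) \<Rightarrow> real" where
  "m0 v = (\<Sum>k. v (Suc k))"

text \<open>\<open>v\<close> solves the (subcritical) equations on \<open>[0,\<infinity>)\<close> with rate function \<open>lam\<close>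
  and initial condition \<open>v0\<close>; the critical equations are the case \<open>lam = (\<lambda>_. 0)\<close>.\<close>
definition coag_sol :: "(real \<Rightarrow> real) \<Rightarrow> (nat \<Rightarrow> real) \<Rightarrow> (real \<Rightarrow> nat \<Rightarrow> real) \<Rightarrow> bool" where
  "coag_sol lam v0 v \<longleftrightarrow>
     (\<forall>t\<ge>0. inN (v t)) \<and>
     (\<forall>t\<ge>0. \<forall>k\<ge>1.
        ((\<lambda>s. real k / 2 * (\<Sum>l=1..k-1. v s l * v s (k - l))
              - real k * v s k * m0 (v s) - lam s * real k * v s k)
          has_integral (v t k - v0 k)) {0..t}) \<and>
     (\<forall>s t. 0 \<le> s \<longrightarrow> s \<le> t \<longrightarrow>
        0 \<le> m0 v0 - m0 (v s) \<and> m0 v0 - m0 (v s) \<le> m0 v0 - m0 (v t)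
        \<and> m0 v0 - m0 (v t) < m0 v0)"

end

theory Submission
  imports Defs
begin

text \<open>With \<open>A t = \<integral>\<^sub>0\<^sup>t (m0 + lam)\<close>, the functions \<open>w_k = exp (k A) v_k\<close> satisfy
  \<open>w_k' = k/2 \<Sum> w_l w_(k-l)\<close>, so they depend on the initial condition only. Hence
  \<open>m0 (v t) = \<Sum> w_k(t) exp (- k A t)\<close> is decreasing in \<open>A t\<close>, and comparing \<open>A' = m0 + lam\<close> for the
  subcritical and the critical equations yields \<open>A \<le> A_n \<le> A + \<integral> lam_n\<close>. This gives the convergence
  of \<open>v^n_k(t)\<close> and of the masses at every \<open>t\<close>, the subcritical mass being the smaller one.

  The masses are decreasing, so the convergence is uniform once the critical mass is known to be
  continuous and to tend to 0. Both follow from the method of characteristics: the generating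
  function \<open>X(t, x) = \<Sum> v_k(t) exp (- k x)\<close> is constant along \<open>x + u t - A t\<close> with \<open>u = X(0, x)\<close>, and
  a characteristic with \<open>u < m0 (v t)\<close> has not reached the origin before time \<open>t\<close>.\<close>

section \<open>Integrating factors\<close>

text \<open>The difference quotient is at most \<open>C * \<bar>t - s\<bar>\<close>. This disposes
  of the remainder terms when an integrating factor is differentiated.\<close>

lemma DERIV_zero_if_quadratic:
  fixes f :: "real \<Rightarrow> real"
  assumes "d > 0" and le: "\<And>t. t \<in> S \<Longrightarrow> \<bar>t - s\<bar> < d \<Longrightarrow> \<bar>f t - f s\<bar> \<le> C * (t - s)^2"
  shows "(f has_real_derivative 0) (at s within S)"
proof -
  have lim: "((\<lambda>t. C * \<bar>t - s\<bar>) \<longlongrightarrow> 0) (at s within S)"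
    by (auto intro!: tendsto_eq_intros)
  have "\<forall>\<^sub>F t in at s within S. norm ((f t - f s) / (t - s)) \<le> C * \<bar>t - s\<bar>"
    unfolding eventually_at
  proof (intro exI[of _ d] conjI ballI impI)
    fix t assume t: "t \<in> S" "t \<noteq> s \<and> dist t s < d"
    have "\<bar>f t - f s\<bar> \<le> (C * \<bar>t - s\<bar>) * \<bar>t - s\<bar>"
      using le[of t] t by (simp add: dist_real_def power2_eq_square mult.assoc)
    then show "norm ((f t - f s) / (t - s)) \<le> C * \<bar>t - s\<bar>"
      using t by (simp add: pos_divide_le_eq)
  qed (rule \<open>d > 0\<close>)
  then show ?thesis
    unfolding has_field_derivative_iff by (rule Lim_null_comparison[OF _ lim])
qed

lemma continuous_on_Icc_bounded:
  fixes f :: "real \<Rightarrow> real"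
  assumes "continuous_on {a..b} f"
  shows "\<exists>B. \<forall>x\<in>{a..b}. \<bar>f x\<bar> \<le> B"
  using compact_imp_bounded[OF compact_continuous_image[OF assms compact_Icc]]
  by (simp add: bounded_iff)

text \<open>For \<open>x < 0\<close> the upper bound follows from
  \<open>exp x \<le> 1 / (1 - x)\<close> and
  \<open>(1 + x + x^2) * (1 - x) = 1 - x^3 \<ge> 1\<close>.\<close>

lemma exp_taylor1:
  fixes x :: real
  assumes "\<bar>x\<bar> \<le> 1"
  shows "\<bar>exp x - (1 + x)\<bar> \<le> x\<^sup>2"
proof -
  have "exp x \<le> 1 + x + x\<^sup>2"
  proof (cases "x \<ge> 0")
    case True
    then show ?thesis using exp_bound[of x] assms by simp
  next
    case False
    have "exp x = 1 / exp (- x)" by (simp add: exp_minus field_simps)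
    also have "\<dots> \<le> 1 / (1 - x)"
      using exp_ge_add_one_self[of "- x"] False by (intro divide_left_mono) auto
    also have "1 / (1 - x) \<le> 1 + x + x\<^sup>2"
    proof -
      have "x ^ 3 \<le> 0" using False by (simp add: power_le_zero_eq)
      then have "1 \<le> (1 + x + x\<^sup>2) * (1 - x)"
        by (simp add: algebra_simps power2_eq_square power3_eq_cube)
      then show ?thesis using False by (simp add: pos_divide_le_eq)
    qed
    finally show ?thesis .
  qed
  then show ?thesis using exp_ge_add_one_self[of x] by simp
qed

text \<open>The coefficient \<open>a\<close> need not be continuous: at a fixed \<open>t\<close> the function
  \<open>y + y t * \<integral>a\<close> is the integral of \<open>g - a * (y - y t)\<close>, which is continuous at \<open>t\<close>,
  and the remaining terms of the product are of second order.\<close>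

lemma DERIV_integrating_factor:
  fixes a g y :: "real \<Rightarrow> real"
  assumes a: "a integrable_on {0..T}" and aL: "\<And>s. s \<in> {0..T} \<Longrightarrow> \<bar>a s\<bar> \<le> L"
    and g: "continuous_on {0..T} g"
    and y: "\<And>t. t \<in> {0..T} \<Longrightarrow> ((\<lambda>s. g s - a s * y s) has_integral (y t - y0)) {0..t}"
    and t: "t \<in> {0..T}"
  defines "A \<equiv> \<lambda>t. integral {0..t} a"
  shows "((\<lambda>t. exp (A t) * y t) has_real_derivative exp (A t) * g t) (at t within {0..T})"
proof -
  define F where "F = (\<lambda>s. g s - a s * y s)"
  have L0: "0 \<le> L" using aL[OF t] by linarith
  have y_eq: "y s = y0 + integral {0..s} F" if "s \<in> {0..T}" for s
    using integral_unique[OF y[OF that]] by (simp add: F_def)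
  have F_int: "F integrable_on {0..T}"
    using has_integral_integrable[OF y[of T]] t by (simp add: F_def)
  have cont_y: "continuous_on {0..T} y"
    using continuous_on_add[OF continuous_on_const[of _ y0] indefinite_integral_continuous_1[OF F_int]]
    by (rule continuous_on_eq) (simp add: y_eq)
  obtain Y where Y: "\<And>s. s \<in> {0..T} \<Longrightarrow> \<bar>y s\<bar> \<le> Y"
    using continuous_on_Icc_bounded[OF cont_y] by blast
  obtain G where G: "\<And>s. s \<in> {0..T} \<Longrightarrow> \<bar>g s\<bar> \<le> G"
    using continuous_on_Icc_bounded[OF g] by blast
  have lip: "\<bar>integral {0..r} f - integral {0..s} f\<bar> \<le> B * \<bar>r - s\<bar>"
    if f: "f integrable_on {0..T}" and fB: "\<And>x. x \<in> {0..T} \<Longrightarrow> \<bar>f x\<bar> \<le> B"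
      and r: "r \<in> {0..T}" "s \<in> {0..T}"
    for f B and r s :: real
  proof -
    have le: "\<bar>integral {0..r} f - integral {0..s} f\<bar> \<le> B * (r - s)"
      if rs: "s \<le> r" "r \<in> {0..T}" "s \<in> {0..T}" for r s
    proof -
      have i: "f integrable_on {0..r}" "f integrable_on {s..r}"
        using rs by (auto intro: integrable_subinterval_real[OF f])
      have "integral {0..s} f + integral {s..r} f = integral {0..r} f"
        using rs i by (intro Henstock_Kurzweil_Integration.integral_combine) auto
      moreover have "norm (integral (cbox s r) f) \<le> B * measure lborel (cbox s r)"
      proof (rule integrable_bound)
        show "0 \<le> B" using fB[OF rs(2)] by linarith
      qed (use rs i fB in auto)
      ultimately show ?thesis using rs by simp
    qed
    show ?thesis
      using le[of r s] le[of s r] r by (cases "s \<le> r") (auto simp: abs_minus_commute)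
  qed
  define K where "K = G + L * Y"
  have F_le: "\<bar>F s\<bar> \<le> K" if "s \<in> {0..T}" for s
  proof -
    have "\<bar>a s * y s\<bar> \<le> L * Y" unfolding abs_mult
      using aL[OF that] Y[OF that] L0 by (intro mult_mono) auto
    then show ?thesis using G[OF that] by (simp add: F_def K_def)
  qed
  have K0: "0 \<le> K" using F_le[OF t] by linarith
  have A_lip: "\<bar>A s - A t\<bar> \<le> L * \<bar>s - t\<bar>" if "s \<in> {0..T}" for s
    unfolding A_def using lip[OF a aL that t] by blast
  have y_lip: "\<bar>y s - y t\<bar> \<le> K * \<bar>s - t\<bar>" if "s \<in> {0..T}" for s
    using lip[OF F_int F_le that t] y_eq that t by simp
  \<comment> \<open>With \<open>D = A s - A t\<close>, the product \<open>exp D * y s\<close> splits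
    into the linear part \<open>P s - y t * A t\<close>, the Taylor remainder
    \<open>y t * R s\<close> and the product of increments \<open>Q s\<close>. Only the first
    contributes to the derivative at \<open>t\<close>.\<close>
  define R where "R = (\<lambda>s. exp (A s - A t) - (1 + (A s - A t)))"
  define Q where "Q = (\<lambda>s. (exp (A s - A t) - 1) * (y s - y t))"
  define P where "P = (\<lambda>s. y s + y t * A s)"
  \<comment> \<open>This radius keeps \<open>\<bar>A s - A t\<bar> \<le> 1\<close>, the range of
    \<open>exp_taylor1\<close>; the summand 1 covers \<open>L = 0\<close>.\<close>
  define d where "d = 1 / (L + 1)"
  have d: "d > 0" using L0 by (simp add: d_def)
  have small: "\<bar>A s - A t\<bar> \<le> 1" if "s \<in> {0..T}" "\<bar>s - t\<bar> < d" for s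
  proof -
    have "\<bar>A s - A t\<bar> \<le> L * \<bar>s - t\<bar>" by (rule A_lip[OF that(1)])
    also have "\<dots> \<le> L * d" using that L0 by (intro mult_left_mono) auto
    also have "\<dots> \<le> 1" using L0 by (simp add: d_def divide_simps)
    finally show ?thesis .
  qed
  have dR: "(R has_real_derivative 0) (at t within {0..T})"
  proof (rule DERIV_zero_if_quadratic[OF d, where C = "L\<^sup>2"])
    fix s assume s: "s \<in> {0..T}" "\<bar>s - t\<bar> < d"
    have "\<bar>R s\<bar> \<le> (A s - A t)\<^sup>2"
      unfolding R_def by (rule exp_taylor1[OF small[OF s]])
    also have "\<dots> = \<bar>A s - A t\<bar>\<^sup>2" by simp
    also have "\<dots> \<le> (L * \<bar>s - t\<bar>)\<^sup>2" by (intro power_mono A_lip s) auto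
    finally show "\<bar>R s - R t\<bar> \<le> L\<^sup>2 * (s - t)\<^sup>2" by (simp add: R_def power_mult_distrib)
  qed
  have dQ: "(Q has_real_derivative 0) (at t within {0..T})"
  proof (rule DERIV_zero_if_quadratic[OF d, where C = "2 * L * K"])
    fix s assume s: "s \<in> {0..T}" "\<bar>s - t\<bar> < d"
    have "\<bar>R s\<bar> \<le> (A s - A t)\<^sup>2"
      unfolding R_def by (rule exp_taylor1[OF small[OF s]])
    also have "\<dots> = \<bar>A s - A t\<bar> * \<bar>A s - A t\<bar>" by (simp add: power2_eq_square)
    also have "\<dots> \<le> \<bar>A s - A t\<bar> * 1" by (intro mult_left_mono small s) auto
    finally have "\<bar>R s + (A s - A t)\<bar> \<le> 2 * \<bar>A s - A t\<bar>"
      using abs_triangle_ineq[of "R s" "A s - A t"] by simp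
    then have "\<bar>exp (A s - A t) - 1\<bar> \<le> 2 * \<bar>A s - A t\<bar>" by (simp add: R_def)
    also have "\<dots> \<le> 2 * (L * \<bar>s - t\<bar>)" using A_lip[OF s(1)] by simp
    finally have "\<bar>Q s\<bar> \<le> 2 * (L * \<bar>s - t\<bar>) * (K * \<bar>s - t\<bar>)"
      unfolding Q_def abs_mult using L0 by (intro mult_mono y_lip s) auto
    then show "\<bar>Q s - Q t\<bar> \<le> 2 * L * K * (s - t)\<^sup>2"
      by (simp add: Q_def power2_eq_square algebra_simps flip: abs_mult)
  qed
  have dP: "(P has_real_derivative g t) (at t within {0..T})"
  proof -
    define H where "H = (\<lambda>s. g s - a s * (y s - y t))"
    have H_eq: "H = (\<lambda>s. F s + y t * a s)" by (auto simp: H_def F_def algebra_simps)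
    have ya: "(\<lambda>s. y t * a s) integrable_on {0..T}" using a by (rule integrable_on_mult_right)
    have int_H: "H integrable_on {0..T}" unfolding H_eq by (intro integrable_add F_int ya)
    have P_eq: "P s = y0 + integral {0..s} H" if "s \<in> {0..T}" for s
    proof -
      have "F integrable_on {0..s}" "a integrable_on {0..s}"
        using that by (auto intro: integrable_subinterval_real[OF F_int] integrable_subinterval_real[OF a])
      then have "integral {0..s} H = integral {0..s} F + y t * integral {0..s} a"
        unfolding H_eq by (subst integral_add) (auto intro: integrable_on_mult_right)
      then show ?thesis using y_eq[OF that] by (simp add: P_def A_def)
    qed
    have lim: "((\<lambda>s. a s * (y s - y t)) \<longlongrightarrow> 0) (at t within {0..T})"
    proof (rule Lim_null_comparison)
      show "\<forall>\<^sub>F s in at t within {0..T}. norm (a s * (y s - y t)) \<le> L * \<bar>y s - y t\<bar>"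
        by (auto simp: eventually_at_filter abs_mult intro!: always_eventually mult_right_mono aL)
      have "(y \<longlongrightarrow> y t) (at t within {0..T})"
        using cont_y t by (simp add: continuous_on_def)
      then show "((\<lambda>s. L * \<bar>y s - y t\<bar>) \<longlongrightarrow> 0) (at t within {0..T})"
        by (auto intro!: tendsto_eq_intros)
    qed
    have "(g \<longlongrightarrow> g t) (at t within {0..T})"
      using g t by (simp add: continuous_on_def)
    from tendsto_diff[OF this lim] have "continuous (at t within {0..T}) H"
      by (simp add: continuous_within H_def)
    then have "((\<lambda>s. integral {0..s} H) has_real_derivative H t) (at t within {0..T})"
      using integral_has_vector_derivative_continuous_at[OF int_H, of t "{}"] t
      by (simp add: has_real_derivative_iff_has_vector_derivative)
    then have "((\<lambda>s. y0 + integral {0..s} H) has_real_derivative H t) (at t within {0..T})"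
      by (auto intro!: derivative_eq_intros)
    then have "(P has_real_derivative H t) (at t within {0..T})"
      by (rule has_field_derivative_transform_within[OF _ zero_less_one t]) (simp add: P_eq)
    then show ?thesis by (simp add: H_def)
  qed
  have "P s - y t * A t + y t * R s + Q s = exp (A s - A t) * y s" for s
    by (simp add: P_def Q_def R_def algebra_simps)
  then have "exp (A s) * y s = exp (A t) * (P s - y t * A t + y t * R s + Q s)" for s
    by (simp add: exp_diff)
  moreover have "((\<lambda>s. exp (A t) * (P s - y t * A t + y t * R s + Q s)) has_real_derivative exp (A t) * g t)
      (at t within {0..T})"
    by (auto intro!: derivative_eq_intros dP dQ dR)
  ultimately show ?thesis by simp
qed

section \<open>Generating functions\<close>

text \<open>The power series with coefficients \<open>a k\<close> at \<open>z = exp (- x)\<close>.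
  In the variable \<open>x\<close>, multiplying each \<open>a k\<close> by
  \<open>exp (- (k * c))\<close> amounts to replacing \<open>x\<close> by
  \<open>x + c\<close>.\<close>

definition gen :: "(nat \<Rightarrow> real) \<Rightarrow> real \<Rightarrow> real" where
  "gen a x = (\<Sum>k. a (Suc k) * exp (- (real (Suc k) * x)))"

lemma gen_0: "gen a 0 = m0 a"
  by (simp add: gen_def m0_def)

lemma gen_cong: "(\<And>k. k \<ge> 1 \<Longrightarrow> a k = b k) \<Longrightarrow> gen a x = gen b x"
  by (simp add: gen_def)

lemma inN_nonneg: "inN a \<Longrightarrow> 0 \<le> a (Suc k)"
  by (simp add: inN_def)

lemma inN_summable: "inN a \<Longrightarrow> summable (\<lambda>k. a (Suc k))"
  by (simp add: inN_def)

lemma gen_term_le: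
  assumes "inN a" "0 \<le> x"
  shows "a (Suc k) * exp (- (real (Suc k) * x)) \<le> a (Suc k)"
  using assms inN_nonneg[OF assms(1), of k] by (intro mult_left_le) auto

lemma summable_gen:
  assumes "inN a" "0 \<le> x"
  shows "summable (\<lambda>k. a (Suc k) * exp (- (real (Suc k) * x)))"
  by (rule summable_comparison_test'[OF inN_summable[OF assms(1)]])
    (use gen_term_le[OF assms] inN_nonneg[OF assms(1)] in \<open>simp add: abs_mult\<close>)

lemma gen_antimono:
  assumes "inN a" "0 \<le> x" "x \<le> y"
  shows "gen a y \<le> gen a x"
  unfolding gen_def using assms
  by (intro suminf_le summable_gen) (auto intro!: mult_left_mono inN_nonneg)

lemma gen_le_m0: "inN a \<Longrightarrow> 0 \<le> x \<Longrightarrow> gen a x \<le> m0 a"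
  using gen_antimono[of a 0 x] by (simp add: gen_0)

lemma gen_nonneg: "inN a \<Longrightarrow> 0 \<le> x \<Longrightarrow> 0 \<le> gen a x"
  unfolding gen_def by (intro suminf_nonneg summable_gen) (simp_all add: inN_nonneg)

lemma m0_nonneg: "inN a \<Longrightarrow> 0 \<le> m0 a"
  using gen_nonneg[of a 0] by (simp add: gen_0)

lemma le_m0: "inN a \<Longrightarrow> a (Suc k) \<le> m0 a"
  unfolding m0_def using sum_le_suminf[OF inN_summable, of a "{k}"] inN_nonneg[of a] by simp

lemma sum_le_m0: "inN a \<Longrightarrow> (\<Sum>k<n. a (Suc k)) \<le> m0 a"
  unfolding m0_def by (rule sum_le_suminf) (auto intro: inN_summable inN_nonneg)

lemma m0_le:
  assumes "inN a" "\<And>n. (\<Sum>k<n. a (Suc k)) \<le> u"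
  shows "m0 a \<le> u"
  unfolding m0_def using assms by (intro suminf_le_const inN_summable)

lemma gen_le_exp:
  assumes "inN a" "0 \<le> x"
  shows "gen a x \<le> m0 a * exp (- x)"
proof -
  have "gen a x \<le> (\<Sum>k. a (Suc k) * exp (- x))"
    unfolding gen_def using assms
    by (intro suminf_le summable_gen summable_mult2 inN_summable mult_left_mono)
      (auto intro: inN_nonneg simp: algebra_simps)
  also have "\<dots> = m0 a * exp (- x)"
    unfolding m0_def by (rule suminf_mult2[symmetric]) (rule inN_summable[OF assms(1)])
  finally show ?thesis .
qed

lemma continuous_on_gen:
  assumes "inN a"
  shows "continuous_on {0..} (gen a)"
proof (rule uniform_limit_theorem)
  show "uniform_limit {0..} (\<lambda>n x. \<Sum>k<n. a (Suc k) * exp (- (real (Suc k) * x))) (gen a) sequentially"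
    unfolding gen_def
    by (rule Weierstrass_m_test[OF _ inN_summable[OF assms]])
      (use gen_term_le[OF assms] inN_nonneg[OF assms] in \<open>auto simp: abs_mult\<close>)
qed (auto intro!: always_eventually continuous_intros)

lemma gen_small:
  assumes "inN a" "0 < e"
  obtains x where "0 < x" "gen a x < e"
proof -
  \<comment> \<open>Chosen such that \<open>m0 a < e * x\<close>, while
    \<open>x \<le> exp x\<close>.\<close>
  define x where "x = (m0 a + 1) / e"
  have m: "0 \<le> m0 a" by (rule m0_nonneg[OF assms(1)])
  have x: "0 < x" using m assms by (simp add: x_def)
  have "gen a x \<le> m0 a * exp (- x)" by (rule gen_le_exp) (use assms x in auto)
  also have "m0 a * exp (- x) < e"
  proof -
    have "m0 a < e * x" using assms by (simp add: x_def)
    also have "\<dots> \<le> e * exp x"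
      using exp_ge_add_one_self[of x] assms by (intro mult_left_mono) linarith+
    finally show ?thesis by (simp add: exp_minus field_simps)
  qed
  finally show thesis using that x by blast
qed

text \<open>The convexity gap is the series of the terms
  \<open>a (Suc k) * (e k x - e k y)^2\<close>, and positive mass makes one of them
  positive.\<close>

lemma gen_strictly_convex:
  assumes a: "inN a" "0 < m0 a" and xy: "0 \<le> x" "0 \<le> y" "x \<noteq> y"
  shows "2 * gen a ((x + y) / 2) < gen a x + gen a y"
proof -
  define e where "e = (\<lambda>k z. exp (- (real (Suc k) * z / 2)))"
  define q where "q = (\<lambda>k. a (Suc k) * (e k x - e k y)\<^sup>2)"
  have e: "e k z * e k z' = exp (- (real (Suc k) * ((z + z') / 2)))" for k z z'
    by (simp add: e_def algebra_simps add_divide_distrib flip: exp_add)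
  have q_eq: "q k = a (Suc k) * exp (- (real (Suc k) * x)) + a (Suc k) * exp (- (real (Suc k) * y))
      - 2 * (a (Suc k) * exp (- (real (Suc k) * ((x + y) / 2))))" for k
  proof -
    have "q k = a (Suc k) * (e k x * e k x) + a (Suc k) * (e k y * e k y) - 2 * (a (Suc k) * (e k x * e k y))"
      by (simp add: q_def power2_eq_square algebra_simps)
    then show ?thesis unfolding e by simp
  qed
  have q_sums: "q sums (gen a x + gen a y - 2 * gen a ((x + y) / 2))"
    unfolding q_eq[abs_def] gen_def using a xy
    by (intro sums_diff sums_add sums_mult summable_sums summable_gen) auto
  have "0 < suminf q"
  proof -
    obtain k where k: "a (Suc k) \<noteq> 0"
      using a(2) by (force simp: m0_def)
    have "e k x \<noteq> e k y" using xy by (simp add: e_def)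
    then have "0 < q k" using k inN_nonneg[OF a(1), of k] by (simp add: q_def order_less_le)
    moreover have "0 \<le> q n" for n by (simp add: q_def inN_nonneg[OF a(1)])
    ultimately show ?thesis using q_sums by (intro suminf_pos2[of q k]) (auto simp: sums_iff)
  qed
  with q_sums show ?thesis by (simp add: sums_iff)
qed

text \<open>Up to a factor this is the derivative of the geometric series in
  \<open>exp (- d)\<close>. It serves as the majorant when \<open>gen\<close> is differentiated term
  by term.\<close>

lemma summable_Suc_mult_exp:
  assumes "0 < d"
  shows "summable (\<lambda>k. real (Suc k) * exp (- (real (Suc k) * d)))"
proof -
  have "summable (\<lambda>k. real (Suc k) * exp (- d) ^ k)"
    using geometric_deriv_sums[of "exp (- d)"] assms by (simp add: sums_iff)
  from summable_mult[OF this, of "exp (- d)"] show ?thesis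
    by (rule summable_cong[THEN iffD1, OF always_eventually, rotated])
      (simp add: exp_of_nat_mult[symmetric] algebra_simps flip: exp_add)
qed

text \<open>Symmetrising \<open>l \<mapsto> k - l\<close> turns the weight \<open>l\<close> of the Cauchy product into \<open>k/2\<close>.\<close>

lemma sums_convolution:
  fixes p :: "nat \<Rightarrow> real"
  assumes p: "\<And>k. 0 \<le> p (Suc k)" "summable (\<lambda>k. p (Suc k))"
    and kp: "summable (\<lambda>k. real (Suc k) * p (Suc k))"
  shows "(\<lambda>k. real (Suc k) / 2 * (\<Sum>l=1..k. p l * p (Suc k - l))) sums
    ((\<Sum>k. p (Suc k)) * (\<Sum>k. real (Suc k) * p (Suc k)))"
proof -
  have "(\<lambda>n. \<Sum>i\<le>n. p (Suc i) * (real (Suc (n - i)) * p (Suc (n - i)))) sums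
    ((\<Sum>k. p (Suc k)) * (\<Sum>k. real (Suc k) * p (Suc k)))"
    using assms by (intro Cauchy_product_sums) simp_all
  moreover have "(\<Sum>i\<le>n. p (Suc i) * (real (Suc (n - i)) * p (Suc (n - i)))) =
    real (Suc (Suc n)) / 2 * (\<Sum>l=1..Suc n. p l * p (Suc (Suc n) - l))" (is "?S = _") for n
  proof -
    have "?S = (\<Sum>i\<le>n. p (Suc (n - i)) * (real (Suc i) * p (Suc i)))"
      by (rule sum.reindex_bij_witness[of _ "\<lambda>i. n - i" "\<lambda>i. n - i"]) auto
    then have "2 * ?S = (\<Sum>i\<le>n. p (Suc i) * (real (Suc (n - i)) * p (Suc (n - i)))
        + p (Suc (n - i)) * (real (Suc i) * p (Suc i)))"
      by (simp add: sum.distrib)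
    also have "\<dots> = (\<Sum>i\<le>n. real (Suc (Suc n)) * (p (Suc i) * p (Suc (n - i))))"
      by (rule sum.cong) (auto simp: algebra_simps of_nat_diff)
    also have "\<dots> = real (Suc (Suc n)) * (\<Sum>i\<le>n. p (Suc i) * p (Suc (n - i)))"
      by (simp add: sum_distrib_left)
    also have "(\<Sum>i\<le>n. p (Suc i) * p (Suc (n - i))) = (\<Sum>l=1..Suc n. p l * p (Suc (Suc n) - l))"
      by (rule sum.reindex_bij_witness[of _ "\<lambda>l. l - 1" Suc]) (auto simp: Suc_diff_le)
    finally show ?thesis by simp
  qed
  ultimately have *: "(\<lambda>n. real (Suc (Suc n)) / 2 * (\<Sum>l=1..Suc n. p l * p (Suc (Suc n) - l))) sums
    ((\<Sum>k. p (Suc k)) * (\<Sum>k. real (Suc k) * p (Suc k)))" by (simp only:)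
  \<comment> \<open>The term at \<open>k = 0\<close> is an empty sum, so undoing the index shift
    leaves the value unchanged.\<close>
  show ?thesis using sums_Suc[OF *] by simp
qed

section \<open>Independence of the rate function\<close>

text \<open>Covers the subcritical equations and, with \<open>lam\<close> zero, the critical
  ones.\<close>

locale coagulation =
  fixes lam :: "real \<Rightarrow> real" and v0 :: "nat \<Rightarrow> real" and v :: "real \<Rightarrow> nat \<Rightarrow> real"
  assumes lam_cont: "continuous_on {0..} lam"
    and sol: "coag_sol lam v0 v"
begin

definition A :: "real \<Rightarrow> real" where
  "A t = integral {0..t} (\<lambda>s. m0 (v s) + lam s)"

definition w :: "nat \<Rightarrow> real \<Rightarrow> real" where
  "w k t = exp (real k * A t) * v t k"

lemma inN_v: "0 \<le> t \<Longrightarrow> inN (v t)"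
  using sol by (simp add: coag_sol_def)

lemma v_integral:
  "0 \<le> t \<Longrightarrow> 1 \<le> k \<Longrightarrow>
    ((\<lambda>s. real k / 2 * (\<Sum>l=1..k-1. v s l * v s (k - l)) - real k * v s k * m0 (v s)
      - lam s * real k * v s k) has_integral (v t k - v0 k)) {0..t}"
  using sol by (simp add: coag_sol_def)

lemma mass_antimono: "0 \<le> s \<Longrightarrow> s \<le> t \<Longrightarrow> m0 (v t) \<le> m0 (v s)"
  using sol unfolding coag_sol_def by force

lemma mass_pos: "0 \<le> t \<Longrightarrow> 0 < m0 (v t)"
  using sol unfolding coag_sol_def by force

lemma mass_nonneg: "0 \<le> t \<Longrightarrow> 0 \<le> m0 (v t)"
  using mass_pos less_imp_le by blast

lemma mass_le: "0 \<le> t \<Longrightarrow> m0 (v t) \<le> m0 v0"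
  using sol unfolding coag_sol_def by force

text \<open>The initial condition is encoded in the integral equation: at \<open>t = 0\<close> the
  integral is over a single point.\<close>

lemma v_0: "1 \<le> k \<Longrightarrow> v 0 k = v0 k"
  using has_integral_unique[OF v_integral[of 0 k, unfolded atLeastAtMost_singleton] has_integral_refl(2)]
  by simp

lemma gen_v_0: "gen (v 0) x = gen v0 x"
  by (rule gen_cong) (rule v_0)

lemma inN_v0: "inN v0"
  using inN_v[of 0] v_0 by (simp add: inN_def)

lemma A_0 [simp]: "A 0 = 0"
  by (simp add: A_def)

text \<open>Monotone functions are integrable; continuity of the mass is established only in
  \<open>continuous_on_mass\<close>.\<close>

lemma mass_integrable: "(\<lambda>s. m0 (v s)) integrable_on {0..t}"
proof -
  have "(\<lambda>s. - m0 (v s)) integrable_on {0..t}"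
    by (rule integrable_on_mono_on) (auto intro!: mono_onI mass_antimono)
  then show ?thesis using integrable_neg by fastforce
qed

lemma lam_integrable: "lam integrable_on {0..t}"
  by (rule integrable_continuous_real) (rule continuous_on_subset[OF lam_cont], auto)

lemma A_eq: "A t = integral {0..t} (\<lambda>s. m0 (v s)) + integral {0..t} lam"
  unfolding A_def by (rule integral_add[OF mass_integrable lam_integrable])

lemma continuous_on_v:
  assumes "1 \<le> k"
  shows "continuous_on {0..t} (\<lambda>s. v s k)"
proof (cases "0 \<le> t")
  case True
  define F where "F = (\<lambda>s. real k / 2 * (\<Sum>l=1..k-1. v s l * v s (k - l)) - real k * v s k * m0 (v s)
      - lam s * real k * v s k)"
  have F: "(F has_integral (v s k - v0 k)) {0..s}" if "0 \<le> s" for s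
    unfolding F_def by (rule v_integral[OF that assms])
  have "F integrable_on {0..t}" using F[OF True] by blast
  from continuous_on_add[OF continuous_on_const[of _ "v0 k"] indefinite_integral_continuous_1[OF this]]
  show ?thesis
    by (rule continuous_on_eq) (simp add: integral_unique[OF F])
qed simp

lemma continuous_on_A: "continuous_on {0..} A"
proof -
  have "continuous_on {0..t} A" for t
    unfolding A_def by (intro indefinite_integral_continuous_1 integrable_add mass_integrable lam_integrable)
  then have "continuous (at s within {0..s + 1}) A" if "0 \<le> s" for s
    using that by (auto simp: continuous_on_eq_continuous_within)
  moreover have "at s within {0..s + 1} = at s within {0..}" if "0 \<le> s" for s :: real
    by (rule at_within_nhd[of s "{..<s + 1}"]) auto
  ultimately show ?thesis by (simp add: continuous_on_eq_continuous_within)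
qed

lemma w_0: "1 \<le> k \<Longrightarrow> w k 0 = v0 k"
  by (simp add: w_def v_0)

lemma v_eq_w: "v t k = exp (- (real k * A t)) * w k t"
  by (simp add: w_def flip: exp_add mult.assoc)

lemma w_nonneg: "0 \<le> t \<Longrightarrow> 0 \<le> w (Suc k) t"
  by (simp add: w_def inN_nonneg inN_v)

text \<open>Neither \<open>lam\<close> nor the mass occurs in the equations satisfied by \<open>w\<close>.\<close>

lemma DERIV_w:
  assumes k: "1 \<le> k" and t: "0 \<le> t"
  shows "(w k has_real_derivative real k / 2 * (\<Sum>l=1..k-1. w l t * w (k - l) t)) (at t within {0..})"
proof -
  define g where "g = (\<lambda>s. real k / 2 * (\<Sum>l=1..k-1. v s l * v s (k - l)))"
  define a where "a = (\<lambda>s. real k * (m0 (v s) + lam s))"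
  have int_a: "a integrable_on {0..T}" for T
    unfolding a_def by (intro integrable_on_mult_right integrable_add mass_integrable lam_integrable)
  obtain B where B: "\<And>s. s \<in> {0..t + 1} \<Longrightarrow> \<bar>lam s\<bar> \<le> B"
    using continuous_on_Icc_bounded[of 0 "t + 1" lam] continuous_on_subset[OF lam_cont, of "{0..t + 1}"]
    by (metis atLeastAtMost_iff atLeast_iff subsetI)
  have "((\<lambda>s. exp (integral {0..s} a) * v s k) has_real_derivative exp (integral {0..t} a) * g t)
      (at t within {0..t + 1})"
  proof (rule DERIV_integrating_factor[where L = "real k * (m0 v0 + B)" and ?y0.0 = "v0 k"])
    show "a integrable_on {0..t + 1}" by (rule int_a)
    show "\<bar>a s\<bar> \<le> real k * (m0 v0 + B)" if "s \<in> {0..t + 1}" for s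
    proof -
      have "\<bar>m0 (v s) + lam s\<bar> \<le> m0 v0 + B"
        using B[OF that] mass_le[of s] mass_nonneg[of s] that by auto
      then show ?thesis unfolding a_def abs_mult by (simp add: mult_left_mono)
    qed
    show "continuous_on {0..t + 1} g"
      unfolding g_def by (intro continuous_intros continuous_on_v) auto
    show "((\<lambda>s. g s - a s * v s k) has_integral v r k - v0 k) {0..r}" if "r \<in> {0..t + 1}" for r
      using v_integral[of r k] that k by (simp add: g_def a_def algebra_simps)
  qed (use t in auto)
  moreover have "integral {0..s} a = real k * A s" for s
    by (simp add: a_def A_def)
  moreover have "exp (real k * A t) * g t = real k / 2 * (\<Sum>l=1..k-1. w l t * w (k - l) t)"
  proof -
    have "exp (real k * A t) * (v t l * v t (k - l)) = w l t * w (k - l) t" if "l \<in> {1..k-1}" for l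
    proof -
      have "real k * A t = real l * A t + real (k - l) * A t"
        using that by (auto simp: of_nat_diff algebra_simps)
      then show ?thesis by (simp add: w_def exp_add)
    qed
    then have "exp (real k * A t) * (\<Sum>l=1..k-1. v t l * v t (k - l)) = (\<Sum>l=1..k-1. w l t * w (k - l) t)"
      unfolding sum_distrib_left by (intro sum.cong) auto
    then show ?thesis by (simp add: g_def)
  qed
  moreover have "at t within {0..t + 1} = at t within {0..}"
    using t by (intro at_within_nhd[of t "{..<t + 1}"]) auto
  ultimately show ?thesis by (simp add: w_def[abs_def])
qed

lemma DERIV_w_within:
  assumes "1 \<le> k" "s \<in> {0..t}"
  shows "(w k has_real_derivative real k / 2 * (\<Sum>l=1..k-1. w l s * w (k - l) s)) (at s within {0..t})"
  by (rule DERIV_subset[OF DERIV_w]) (use assms in auto)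

end

text \<open>The derivative of \<open>w k\<close> involves only \<open>w l\<close> with
  \<open>l < k\<close>, so by strong induction the difference of the two versions has derivative 0,
  and it vanishes at time 0.\<close>

lemma coagulation_w_unique:
  assumes "coagulation lam v0 v" "coagulation lam' v0 v'" "1 \<le> k" "0 \<le> t"
  shows "coagulation.w lam v k t = coagulation.w lam' v' k t"
proof -
  interpret a: coagulation lam v0 v by fact
  interpret b: coagulation lam' v0 v' by fact
  show ?thesis using \<open>1 \<le> k\<close> \<open>0 \<le> t\<close>
  proof (induction k arbitrary: t rule: less_induct)
    case (less k)
    have "((\<lambda>s. a.w k s - b.w k s) has_real_derivative 0) (at s within {0..})" if "s \<in> {0..}" for s
    proof -
      have "(\<Sum>l=1..k-1. a.w l s * a.w (k - l) s) = (\<Sum>l=1..k-1. b.w l s * b.w (k - l) s)"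
        using that less.IH by (intro sum.cong) auto
      then show ?thesis
        using DERIV_diff[OF a.DERIV_w[OF less.prems(1)] b.DERIV_w[OF less.prems(1)], of s] that by auto
    qed
    then obtain c where "\<And>s. s \<in> {0..} \<Longrightarrow> a.w k s - b.w k s = c"
      using has_field_derivative_zero_constant[OF convex_real_interval(1), of 0 "\<lambda>s. a.w k s - b.w k s"] by blast
    from this[of 0] this[of t] show ?case
      using less.prems by (simp add: a.w_0 b.w_0)
  qed
qed

section \<open>Characteristics and continuity of the mass\<close>

text \<open>Carries a bound that holds strictly before a hitting time over to that time.\<close>

lemma continuous_on_le_right_endpoint:
  fixes f :: "real \<Rightarrow> real"
  assumes "continuous_on {a..b} f" "a < b" "\<And>s. s \<in> {a..<b} \<Longrightarrow> f s \<le> c"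
  shows "f b \<le> c"
proof (rule tendsto_upperbound)
  show "(f \<longlongrightarrow> f b) (at_left b)"
    using assms(1,2) by (simp add: continuous_on_def flip: at_within_Icc_at_left)
  show "\<forall>\<^sub>F s in at_left b. f s \<le> c"
    unfolding eventually_at_left[OF assms(2)] using assms(2,3) by (intro exI[of _ a]) auto
qed simp

context coagulation
begin

text \<open>One factor is bounded by the mass, the other sums to at most the mass. The bound is
  uniform in \<open>k\<close> and \<open>s\<close>, as the M-test requires.\<close>

lemma convolution_le:
  assumes "0 \<le> s"
  shows "(\<Sum>l=1..k. v s l * v s (Suc k - l)) \<le> (m0 v0)\<^sup>2"
proof -
  note N = inN_v[OF assms]
  have M: "v s (Suc j) \<le> m0 v0" for j
    using le_m0[OF N] mass_le[OF assms] by (rule order_trans)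
  have "(\<Sum>l=1..k. v s l * v s (Suc k - l)) = (\<Sum>j<k. v s (Suc j) * v s (Suc (k - Suc j)))"
    by (rule sum.reindex_bij_witness[of _ Suc "\<lambda>l. l - 1"]) (auto simp: Suc_diff_le Suc_diff_Suc)
  also have "\<dots> \<le> (\<Sum>j<k. v s (Suc j) * m0 v0)"
    using inN_nonneg[OF N] by (intro sum_mono mult_left_mono M)
  also have "\<dots> = (\<Sum>j<k. v s (Suc j)) * m0 v0" by (simp add: sum_distrib_right)
  also have "\<dots> \<le> m0 v0 * m0 v0"
    using sum_le_m0[OF N, of k] mass_le[OF assms] m0_nonneg[OF inN_v0]
    by (intro mult_right_mono) auto
  finally show ?thesis by (simp add: power2_eq_square)
qed

text \<open>Along \<open>s \<mapsto> x + u s - A s\<close> the difference of \<open>gen (v s)\<close> and \<open>u\<close> satisfies a homogeneous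
  linear differential equation, whose coefficient is bounded as long as the curve stays away from 0.\<close>

lemma gen_characteristic:
  assumes t: "0 \<le> t" and u: "u = gen v0 x"
    and pos: "\<And>s. s \<in> {0..t} \<Longrightarrow> 0 < x + u * s - A s"
  shows "gen (v t) (x + u * t - A t) = u"
proof -
  define X where "X = (\<lambda>s. x + u * s - A s)"
  define M where "M = m0 v0"
  \<comment> \<open>\<open>p s j\<close> is the term of index \<open>j\<close> of
    \<open>gen (v s) (X s)\<close>; \<open>f\<close> is the same term with shifted index,
    \<open>f'\<close> its derivative in time, and \<open>B\<close> is minus the derivative of
    \<open>gen (v s)\<close> at \<open>X s\<close>.\<close>
  define p where "p = (\<lambda>s j. v s j * exp (- (real j * X s)))"
  define f where "f = (\<lambda>k s. p s (Suc k))"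
  define f' where "f' = (\<lambda>k s. real (Suc k) / 2 * (\<Sum>l=1..k. p s l * p s (Suc k - l))
    - u * (real (Suc k) * p s (Suc k)))"
  define B where "B = (\<lambda>s. \<Sum>k. real (Suc k) * p s (Suc k))"
  have M0: "0 \<le> M" unfolding M_def by (rule m0_nonneg[OF inN_v0])
  have x0: "0 < x" using pos[of 0] t by simp
  have u0: "0 \<le> u" unfolding u by (rule gen_nonneg[OF inN_v0]) (use x0 in simp)
  have "continuous_on {0..t} A" by (rule continuous_on_subset[OF continuous_on_A]) auto
  then have "continuous_on {0..t} X" unfolding X_def by (intro continuous_intros)
  \<comment> \<open>By compactness the curve keeps a distance \<open>d > 0\<close> from the origin,
    which makes \<open>b\<close> a summable majorant, up to a constant, at all times in
    \<open>{0..t}\<close>.\<close>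
  from continuous_attains_inf[OF compact_Icc _ this] t obtain r
    where r: "r \<in> {0..t}" "\<And>s. s \<in> {0..t} \<Longrightarrow> X r \<le> X s" by auto
  define d where "d = X r"
  have d: "0 < d" "\<And>s. s \<in> {0..t} \<Longrightarrow> d \<le> X s"
    using r pos[OF r(1)] by (auto simp: d_def X_def)
  define b where "b = (\<lambda>k. real (Suc k) * exp (- (real (Suc k) * d)))"
  have b: "summable b" unfolding b_def by (rule summable_Suc_mult_exp[OF d(1)])
  have X0: "0 \<le> X s" if "s \<in> {0..t}" for s using d(1) d(2)[OF that] by simp
  have gen_p: "gen (v s) (X s) = (\<Sum>k. p s (Suc k))" for s
    by (simp add: gen_def p_def)
  have p_nonneg: "0 \<le> p s (Suc k)" if "s \<in> {0..t}" for s k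
    using that by (simp add: p_def inN_nonneg inN_v)
  have p_summable: "summable (\<lambda>k. p s (Suc k))" if "s \<in> {0..t}" for s
    unfolding p_def using that by (intro summable_gen inN_v X0) auto
  have exp_le: "exp (- (real (Suc k) * X s)) \<le> exp (- (real (Suc k) * d))" if "s \<in> {0..t}" for s k
    using d(2)[OF that] by simp
  have kp_le: "real (Suc k) * p s (Suc k) \<le> M * b k" if "s \<in> {0..t}" for s k
  proof -
    have "v s (Suc k) \<le> M"
      unfolding M_def using that by (intro order_trans[OF le_m0 mass_le] inN_v) auto
    then have "p s (Suc k) \<le> M * exp (- (real (Suc k) * d))"
      unfolding p_def using exp_le[OF that] M0 by (intro mult_mono) auto
    then have "real (Suc k) * p s (Suc k) \<le> real (Suc k) * (M * exp (- (real (Suc k) * d)))"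
      by (intro mult_left_mono) auto
    then show ?thesis by (simp add: b_def mult_ac)
  qed
  have kp_summable: "summable (\<lambda>k. real (Suc k) * p s (Suc k))" if "s \<in> {0..t}" for s
    by (rule summable_comparison_test'[OF summable_mult[OF b, of M]])
      (use kp_le[OF that] p_nonneg[OF that] in \<open>simp add: abs_mult\<close>)
  have B_bounds: "0 \<le> B s" "B s \<le> M * suminf b" if "s \<in> {0..t}" for s
  proof -
    show "0 \<le> B s" unfolding B_def
      using p_nonneg[OF that] by (intro suminf_nonneg kp_summable that) simp
    have "B s \<le> (\<Sum>k. M * b k)" unfolding B_def
      by (intro suminf_le kp_le kp_summable that summable_mult b)
    then show "B s \<le> M * suminf b" using suminf_mult[OF b, of M] by simp
  qed
  have conv: "(\<Sum>l=1..k. p s l * p s (Suc k - l))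
      = exp (- (real (Suc k) * X s)) * (\<Sum>l=1..k. v s l * v s (Suc k - l))" for s k
  proof -
    have "p s l * p s (Suc k - l) = exp (- (real (Suc k) * X s)) * (v s l * v s (Suc k - l))"
      if "l \<in> {1..k}" for l
    proof -
      have "- (real (Suc k) * X s) = - (real l * X s) + - (real (Suc k - l) * X s)"
        using that by (simp add: of_nat_diff algebra_simps)
      then show ?thesis by (simp only: p_def exp_add mult_ac)
    qed
    then show ?thesis unfolding sum_distrib_left by (intro sum.cong) auto
  qed
  have f'_le: "norm (f' k s) \<le> (M\<^sup>2 / 2 + u * M) * b k" if "s \<in> {0..t}" for s k
  proof -
    define S where "S = (\<Sum>l=1..k. v s l * v s (Suc k - l))"
    have S: "0 \<le> S" "S \<le> M\<^sup>2"
    proof -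
      show "0 \<le> S" unfolding S_def
        using inN_v[of s] that by (intro sum_nonneg mult_nonneg_nonneg) (auto simp: inN_def)
      show "S \<le> M\<^sup>2" unfolding S_def M_def using that by (intro convolution_le) auto
    qed
    have "exp (- (real (Suc k) * X s)) * S \<le> exp (- (real (Suc k) * d)) * M\<^sup>2"
      using exp_le[OF that] S by (intro mult_mono) auto
    then have "real (Suc k) / 2 * (exp (- (real (Suc k) * X s)) * S)
        \<le> real (Suc k) / 2 * (exp (- (real (Suc k) * d)) * M\<^sup>2)"
      by (rule mult_left_mono) simp
    also have "\<dots> = M\<^sup>2 / 2 * b k" by (simp add: b_def mult_ac)
    finally have 1: "real (Suc k) / 2 * (exp (- (real (Suc k) * X s)) * S) \<le> M\<^sup>2 / 2 * b k" .
    have 2: "u * (real (Suc k) * p s (Suc k)) \<le> u * (M * b k)"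
      by (rule mult_left_mono[OF kp_le[OF that] u0])
    have 3: "0 \<le> real (Suc k) / 2 * (exp (- (real (Suc k) * X s)) * S)"
      using S by simp
    have 4: "0 \<le> u * (real (Suc k) * p s (Suc k))"
      using u0 p_nonneg[OF that, of k] by simp
    have "f' k s = real (Suc k) / 2 * (exp (- (real (Suc k) * X s)) * S) - u * (real (Suc k) * p s (Suc k))"
      unfolding f'_def conv S_def ..
    then have "norm (f' k s) \<le> M\<^sup>2 / 2 * b k + u * (M * b k)"
      using 1 2 3 4 by (simp only: real_norm_def)
    then show ?thesis by (simp add: algebra_simps)
  qed
  \<comment> \<open>\<open>A\<close> is not yet known to be differentiable. Passing to
    \<open>w\<close> cancels it, leaving only differentiable factors.\<close>
  have f_eq: "f k s = w (Suc k) s * exp (- (real (Suc k) * (x + u * s)))" for k s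
    by (simp add: f_def p_def X_def w_def algebra_simps flip: exp_add)
  have df: "(f k has_real_derivative f' k s) (at s within {0..t})" if "s \<in> {0..t}" for k s
  proof -
    define E where "E = exp (- (real (Suc k) * (x + u * s)))"
    define D where "D = real (Suc k) / 2 * (\<Sum>l=1..Suc k-1. w l s * w (Suc k - l) s)"
    have D_eq: "D * E = real (Suc k) / 2 * (\<Sum>l=1..k. p s l * p s (Suc k - l))"
    proof -
      have "w l s * w (Suc k - l) s * E = p s l * p s (Suc k - l)" if "l \<in> {1..k}" for l
      proof -
        have "E = exp (- (real l * (x + u * s))) * exp (- (real (Suc k - l) * (x + u * s)))"
          unfolding E_def exp_add[symmetric] using that by (simp add: of_nat_diff algebra_simps)
        moreover have "p s j = w j s * exp (- (real j * (x + u * s)))" for j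
          by (simp add: p_def X_def w_def algebra_simps flip: exp_add)
        ultimately show ?thesis by (simp only: mult_ac)
      qed
      then show ?thesis unfolding D_def by (simp add: sum_distrib_right mult.assoc)
    qed
    have "((\<lambda>s. exp (- (real (Suc k) * (x + u * s)))) has_real_derivative E * (- (real (Suc k) * u)))
        (at s within {0..t})"
      unfolding E_def by (auto intro!: derivative_eq_intros)
    from DERIV_mult[OF DERIV_w_within[of "Suc k" s t] this]
    have "(f k has_real_derivative D * E + E * (- (real (Suc k) * u)) * w (Suc k) s) (at s within {0..t})"
      using that unfolding f_eq[abs_def] by (simp only: D_def E_def)
    moreover have "E * (- (real (Suc k) * u)) * w (Suc k) s = - (u * (real (Suc k) * p s (Suc k)))"
      using f_eq[of k s] by (simp add: E_def f_def)
    ultimately show ?thesis unfolding D_eq f'_def by (simp only: add_uminus_conv_diff)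
  qed
  \<comment> \<open>By \<open>sums_convolution\<close> the quadratic part sums to
    \<open>gen (v s) (X s) * B s\<close>; this gives the linear equation along the
    characteristic.\<close>
  have f'_suminf: "(\<Sum>k. f' k s) = (gen (v s) (X s) - u) * B s" if "s \<in> {0..t}" for s
  proof -
    have "(\<lambda>k. f' k s) sums ((\<Sum>k. p s (Suc k)) * B s - u * B s)"
      unfolding f'_def B_def
      by (intro sums_diff sums_mult sums_convolution summable_sums p_nonneg p_summable kp_summable that)
    then show ?thesis by (simp add: sums_iff gen_p left_diff_distrib)
  qed
  have "uniform_limit {0..t} (\<lambda>n s. \<Sum>k<n. f' k s) (\<lambda>s. \<Sum>k. f' k s) sequentially"
    by (rule Weierstrass_m_test[OF f'_le summable_mult[OF b]])
  moreover have "summable (\<lambda>k. f k 0)" using p_summable[of 0] t by (simp add: f_def)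
  ultimately have "\<exists>g. \<forall>s\<in>{0..t}. (\<lambda>k. f k s) sums g s
      \<and> (g has_real_derivative (\<Sum>k. f' k s)) (at s within {0..t})"
    using t by (intro has_field_derivative_series[where ?x0.0 = 0]) (simp_all add: df)
  then obtain g where g: "\<And>s. s \<in> {0..t} \<Longrightarrow> (\<lambda>k. f k s) sums g s"
    "\<And>s. s \<in> {0..t} \<Longrightarrow> (g has_real_derivative (\<Sum>k. f' k s)) (at s within {0..t})"
    by blast
  have g_eq: "g s = gen (v s) (X s)" if "s \<in> {0..t}" for s
    using g(1)[OF that] by (simp add: gen_p f_def sums_iff)
  define C where "C = M * suminf b"
  \<comment> \<open>Gronwall's argument: since \<open>B s \<le> C\<close>, the weight makes
    \<open>h\<close> nonincreasing, and \<open>h\<close> starts at 0.\<close>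
  define h where "h = (\<lambda>s. (g s - u)\<^sup>2 * exp (- (2 * C * s)))"
  have dh: "(h has_real_derivative 2 * (g s - u)\<^sup>2 * (B s - C) * exp (- (2 * C * s))) (at s within {0..t})"
    if "s \<in> {0..t}" for s
  proof -
    have dg: "(g has_real_derivative (g s - u) * B s) (at s within {0..t})"
      using g(2)[OF that] f'_suminf[OF that] g_eq[OF that] by simp
    show ?thesis unfolding h_def
      by (rule derivative_eq_intros dg refl)+ (simp add: power2_eq_square algebra_simps)
  qed
  have "h t \<le> h 0"
  proof (rule DERIV_nonpos_imp_decreasing_open[OF t])
    show "\<exists>y. (h has_real_derivative y) (at s) \<and> y \<le> 0" if "0 < s" "s < t" for s
    proof (intro exI conjI)
      show "(h has_real_derivative 2 * (g s - u)\<^sup>2 * (B s - C) * exp (- (2 * C * s))) (at s)"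
        using dh[of s] at_within_Icc_at[OF that] that by simp
      show "2 * (g s - u)\<^sup>2 * (B s - C) * exp (- (2 * C * s)) \<le> 0"
        using B_bounds(2)[of s] that
        by (intro mult_nonpos_nonneg mult_nonneg_nonpos) (auto simp: C_def)
    qed
    show "continuous_on {0..t} h"
      using dh by (rule DERIV_continuous_on)
  qed
  moreover have "h 0 = 0"
    using g_eq[of 0] t by (simp add: h_def X_def gen_v_0 u)
  ultimately have "(g t - u)\<^sup>2 \<le> 0"
    by (simp add: h_def mult_le_0_iff)
  then show ?thesis using g_eq[of t] t by (simp add: X_def)
qed

text \<open>Suppose the curve first reaches the origin at \<open>r \<le> t\<close>. Before
  \<open>r\<close> the generating function equals \<open>u\<close> along it; in the limit the mass
  at \<open>r\<close> is at most \<open>u\<close>, hence so is the mass at \<open>t\<close>.\<close>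

lemma characteristic_pos:
  assumes t: "0 \<le> t" and x: "0 < x" and u: "u = gen v0 x" and less: "u < m0 (v t)"
  shows "0 < x + u * t - A t"
proof (rule ccontr)
  assume neg: "\<not> 0 < x + u * t - A t"
  define X where "X = (\<lambda>s. x + u * s - A s)"
  have X_cont: "continuous_on {0..t} X"
    unfolding X_def by (intro continuous_intros continuous_on_subset[OF continuous_on_A]) auto
  define Z where "Z = {0..t} \<inter> X -` {..0}"
  have "closed Z"
    unfolding Z_def by (rule continuous_closed_preimage[OF X_cont]) auto
  then have "compact Z"
    unfolding compact_eq_bounded_closed by (auto simp: Z_def intro: bounded_subset[OF bounded_closed_interval])
  moreover have "t \<in> Z" using neg t by (simp add: Z_def X_def)
  ultimately obtain r where r: "r \<in> Z" "\<And>s. s \<in> Z \<Longrightarrow> r \<le> s"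
    using compact_attains_inf[of Z] by auto
  have r0: "0 < r" "r \<le> t" "X r \<le> 0"
    using r(1) x by (auto simp: Z_def X_def order_less_le)
  have before: "0 < X s" if "0 \<le> s" "s < r" for s
    using r(2)[of s] that r0 by (force simp: Z_def)
  have X_cont_r: "continuous_on {0..r} X"
    by (rule continuous_on_subset[OF X_cont]) (use r0 in auto)
  \<comment> \<open>Only the single components are known to be continuous in time, so the limit is
    taken in partial sums.\<close>
  have "(\<Sum>k<n. v r (Suc k)) \<le> u" for n
  proof -
    have "(\<Sum>k<n. v r (Suc k)) \<le> (\<Sum>k<n. v r (Suc k) * exp (- (real (Suc k) * X r)))"
    proof (rule sum_mono)
      fix k
      have "1 \<le> exp (- (real (Suc k) * X r))"
        using r0 by (simp add: mult_le_0_iff)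
      then show "v r (Suc k) \<le> v r (Suc k) * exp (- (real (Suc k) * X r))"
        using r0 inN_nonneg[OF inN_v[of r], of k] by (intro mult_le_cancel_left1[THEN iffD2]) auto
    qed
    also have "\<dots> \<le> u"
    proof (rule continuous_on_le_right_endpoint[OF _ r0(1)])
      show "continuous_on {0..r} (\<lambda>s. \<Sum>k<n. v s (Suc k) * exp (- (real (Suc k) * X s)))"
        by (intro continuous_intros continuous_on_v X_cont_r) auto
      fix s assume s: "s \<in> {0..<r}"
      have "(\<Sum>k<n. v s (Suc k) * exp (- (real (Suc k) * X s))) \<le> gen (v s) (X s)"
        unfolding gen_def using s before[of s]
        by (intro sum_le_suminf summable_gen inN_v) (auto simp: inN_nonneg inN_v)
      also have "\<dots> = u"
        unfolding X_def using s before
        by (intro gen_characteristic[OF _ u]) (auto simp: X_def)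
      finally show "(\<Sum>k<n. v s (Suc k) * exp (- (real (Suc k) * X s))) \<le> u" .
    qed
    finally show ?thesis .
  qed
  then have "m0 (v r) \<le> u" using r0 by (intro m0_le inN_v) auto
  moreover have "m0 (v t) \<le> m0 (v r)" using r0 by (intro mass_antimono) auto
  ultimately show False using less by simp
qed

text \<open>If the mass jumped down at \<open>t\<close>, then all characteristics carrying a value \<open>u\<close> in the gap would
  reach the origin exactly at time \<open>t\<close>, so that \<open>x + t * gen v0 x\<close> would be constant on
  an interval. This contradicts the strict convexity of \<open>gen v0\<close>.\<close>

lemma mass_no_jump:
  assumes t: "0 < t" and e: "0 < e"
  shows "\<exists>s\<in>{0..<t}. m0 (v s) < m0 (v t) + e"
proof (rule ccontr)
  assume "\<not> ?thesis"
  then have jump: "m0 (v t) + e \<le> m0 (v s)" if "s \<in> {0..<t}" for s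
    using that by (auto simp: not_less)
  define m where "m = m0 (v t)"
  have m: "0 < m" using mass_pos[of t] t by (simp add: m_def)
  \<comment> \<open>Before \<open>t\<close> the mass exceeds \<open>gen v0 x\<close>, so the
    characteristic stays positive. If it were still positive at \<open>t\<close>, the value
    \<open>gen v0 x > m\<close> would be attained by \<open>gen (v t)\<close>, which is at most
    \<open>m\<close>.\<close>
  have focus: "x + gen v0 x * t = A t" if x: "0 < x" and u: "m < gen v0 x" "gen v0 x < m + e" for x
  proof (rule antisym)
    define X where "X = (\<lambda>s. x + gen v0 x * s - A s)"
    have before: "0 < X s" if "s \<in> {0..<t}" for s
      unfolding X_def using that x u jump[OF that]
      by (intro characteristic_pos[OF _ x refl]) (auto simp: m_def)
    have "- X t \<le> 0"
    proof (rule continuous_on_le_right_endpoint[OF _ t])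
      show "continuous_on {0..t} (\<lambda>s. - X s)"
        unfolding X_def by (intro continuous_intros continuous_on_subset[OF continuous_on_A]) auto
    qed (use before in \<open>auto intro: less_imp_le\<close>)
    then show "A t \<le> x + gen v0 x * t" by (simp add: X_def)
    show "x + gen v0 x * t \<le> A t"
    proof (rule ccontr)
      assume "\<not> ?thesis"
      then have "0 < X s" if "s \<in> {0..t}" for s
        using before[of s] that by (cases "s = t") (auto simp: X_def)
      then have "gen (v t) (X t) = gen v0 x"
        unfolding X_def using t by (intro gen_characteristic) (auto simp: X_def)
      moreover have "gen (v t) (X t) \<le> m"
        unfolding m_def using t \<open>\<And>s. s \<in> {0..t} \<Longrightarrow> 0 < X s\<close>[of t] by (intro gen_le_m0 inN_v) auto
      ultimately show False using u by simp
    qed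
  qed
  obtain z where z: "0 < z" "gen v0 z < m" using gen_small[OF inN_v0 m] by blast
  have g0: "m + e \<le> gen v0 0"
    using jump[of 0] t by (simp add: m_def gen_0[symmetric] gen_v_0)
  have ex: "\<exists>x>0. gen v0 x = c" if c: "m < c" "c < m + e" for c
  proof -
    have "continuous_on {0..z} (gen v0)"
      by (rule continuous_on_subset[OF continuous_on_gen[OF inN_v0]]) auto
    then obtain x where "0 \<le> x" "gen v0 x = c"
      using IVT2'[of "gen v0" z c 0] z g0 c by auto
    moreover have "x \<noteq> 0" using g0 c \<open>gen v0 x = c\<close> by auto
    ultimately show ?thesis by (intro exI[of _ x]) auto
  qed
  \<comment> \<open>Two distinct values inside the gap. By monotonicity the value at the midpoint
    \<open>h\<close> lies between them, so \<open>focus\<close> applies to all three points.\<close>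
  obtain x where x: "0 < x" "gen v0 x = m + e / 3" using ex[of "m + e / 3"] e by auto
  obtain y where y: "0 < y" "gen v0 y = m + 2 * e / 3" using ex[of "m + 2 * e / 3"] e by auto
  define h where "h = (x + y) / 2"
  have "y < x"
    using gen_antimono[OF inN_v0, of x y] x y e by (cases "x \<le> y") auto
  then have "gen v0 x \<le> gen v0 h" "gen v0 h \<le> gen v0 y"
    using y by (intro gen_antimono[OF inN_v0]; simp add: h_def)+
  then have "h + gen v0 h * t = A t"
    using x y e by (intro focus) (auto simp: h_def)
  moreover have "x + gen v0 x * t = A t" "y + gen v0 y * t = A t"
    using x y e by (intro focus; simp)+
  ultimately have "(2 * gen v0 h) * t = (gen v0 x + gen v0 y) * t"
    unfolding h_def distrib_right by argo
  moreover have "2 * gen v0 h < gen v0 x + gen v0 y"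
    unfolding h_def
  proof (rule gen_strictly_convex[OF inN_v0])
    show "0 < m0 v0" using g0 m e by (simp add: gen_0)
  qed (use x y \<open>y < x\<close> in auto)
  ultimately show False using t by simp
qed

text \<open>The mass is lower semicontinuous as a supremum of continuous partial sums. The upper
  bound near \<open>t\<close> comes from monotonicity, together with \<open>mass_no_jump\<close> to
  the left of \<open>t\<close>.\<close>

lemma continuous_on_mass: "continuous_on {0..} (\<lambda>t. m0 (v t))"
  unfolding continuous_on_iff
proof (intro ballI allI impI)
  fix t e :: real assume t: "t \<in> {0..}" and e: "0 < e"
  obtain n where n: "m0 (v t) - e < (\<Sum>k<n. v t (Suc k))"
    using m0_le[OF inN_v[of t], of "m0 (v t) - e"] t e by (force simp: not_le[symmetric])
  define P where "P = (\<lambda>s. \<Sum>k<n. v s (Suc k))"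
  have "continuous_on {0..t + 1} P"
    unfolding P_def by (intro continuous_intros continuous_on_v) auto
  then obtain d where d: "0 < d" "\<And>s. s \<in> {0..t + 1} \<Longrightarrow> dist s t < d \<Longrightarrow> dist (P s) (P t) < P t - (m0 (v t) - e)"
    using t n unfolding continuous_on_iff P_def
    by (metis atLeastAtMost_iff atLeast_iff diff_gt_0_iff_gt le_add_same_cancel1 zero_le_one)
  have lower: "m0 (v t) - e < m0 (v s)" if "0 \<le> s" "s \<le> t + 1" "dist s t < d" for s
    using d(2)[of s] that sum_le_m0[OF inN_v[of s], of n] by (auto simp: dist_real_def P_def)
  obtain r where r: "r < t" "\<And>s. 0 \<le> s \<Longrightarrow> r < s \<Longrightarrow> m0 (v s) < m0 (v t) + e"
  proof (cases "t = 0")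
    case True
    have "m0 (v s) < m0 (v t) + e" if "0 \<le> s" for s
      using mass_antimono[of 0 s] that e True by simp
    \<comment> \<open>At \<open>t = 0\<close> monotonicity alone gives the bound;
      \<open>t - 1\<close> is an arbitrary smaller number.\<close>
    then show ?thesis using that[of "t - 1"] by simp
  next
    case False
    then obtain r where "r \<in> {0..<t}" "m0 (v r) < m0 (v t) + e"
      using mass_no_jump[of t e] t e by auto
    then have "m0 (v s) < m0 (v t) + e" if "0 \<le> s" "r < s" for s
      using mass_antimono[of r s] that by auto
    with \<open>r \<in> {0..<t}\<close> show ?thesis by (intro that[of r]) simp_all
  qed
  show "\<exists>d>0. \<forall>s\<in>{0..}. dist s t < d \<longrightarrow> dist (m0 (v s)) (m0 (v t)) < e"
  proof (intro exI[of _ "min (min d 1) (t - r)"] conjI ballI impI)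
    show "0 < min (min d 1) (t - r)" using d r by simp
    fix s assume "s \<in> {0..}" "dist s t < min (min d 1) (t - r)"
    then show "dist (m0 (v s)) (m0 (v t)) < e"
      using lower[of s] r(2)[of s] by (auto simp: dist_real_def abs_if split: if_splits)
  qed
qed

text \<open>If the mass stayed above \<open>e\<close>, then \<open>A t \<ge> e * t\<close>, and a
  characteristic of speed below \<open>e / 2\<close> would be overtaken although
  \<open>characteristic_pos\<close> keeps it positive.\<close>

lemma mass_arbitrarily_small:
  assumes lam: "\<And>t. 0 \<le> t \<Longrightarrow> 0 \<le> lam t" and e: "0 < e"
  shows "\<exists>t\<ge>0. m0 (v t) < e"
proof (rule ccontr)
  assume "\<not> ?thesis"
  then have ge: "e \<le> m0 (v t)" if "0 \<le> t" for t using that by (auto simp: not_less)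
  obtain x where x: "0 < x" "gen v0 x < e / 2" using gen_small[OF inN_v0, of "e / 2"] e by auto
  \<comment> \<open>At this time \<open>x + e / 2 * t = e * t\<close>.\<close>
  define t where "t = 2 * x / e"
  have t: "0 < t" "e * t = 2 * x" using x e by (simp_all add: t_def)
  have "0 < x + gen v0 x * t - A t"
    using t x ge[of t] e by (intro characteristic_pos[OF _ _ refl]) auto
  moreover have "gen v0 x * t < e / 2 * t" using x t by (intro mult_strict_right_mono)
  moreover have "e * t \<le> A t"
  proof -
    have "integral {0..t} (\<lambda>_. e) \<le> A t"
      unfolding A_def using ge lam
      by (intro integral_le integrable_add mass_integrable lam_integrable) (force intro: add_increasing2)+
    then show ?thesis using t by (simp add: mult.commute)
  qed
  ultimately show False using t by simp
qed

end

section \<open>Comparison of the subcritical and critical equations\<close>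

text \<open>After the last time at which the indefinite integral is nonpositive, \<open>f\<close> is
  nonpositive, so the integral cannot become positive.\<close>

lemma integral_nonpos_if_nonpos_when_pos:
  fixes f :: "real \<Rightarrow> real"
  assumes f: "f integrable_on {0..t}"
    and nonpos: "\<And>s. s \<in> {0..t} \<Longrightarrow> 0 < integral {0..s} f \<Longrightarrow> f s \<le> 0"
  shows "integral {0..t} f \<le> 0"
proof (rule ccontr)
  define F where "F = (\<lambda>s. integral {0..s} f)"
  assume "\<not> integral {0..t} f \<le> 0"
  then have Ft: "0 < F t" by (simp add: F_def)
  have t: "0 \<le> t" using Ft by (cases "0 \<le> t") (auto simp: F_def)
  have F_cont: "continuous_on {0..t} F"
    unfolding F_def by (rule indefinite_integral_continuous_1[OF f])
  define Z where "Z = {0..t} \<inter> F -` {..0}"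
  have "closed Z" unfolding Z_def by (rule continuous_closed_preimage[OF F_cont]) auto
  then have "compact Z"
    unfolding compact_eq_bounded_closed by (auto simp: Z_def intro: bounded_subset[OF bounded_closed_interval])
  moreover have "0 \<in> Z" using t by (simp add: Z_def F_def)
  ultimately obtain r where r: "r \<in> Z" "\<And>s. s \<in> Z \<Longrightarrow> s \<le> r"
    using compact_attains_sup[of Z] by auto
  have r0: "0 \<le> r" "r \<le> t" "F r \<le> 0" using r(1) by (auto simp: Z_def)
  have after: "f s \<le> 0" if "s \<in> {r..t} - {r}" for s
  proof (rule nonpos)
    show "0 < integral {0..s} f"
      using r(2)[of s] that r0 by (force simp: Z_def F_def)
  qed (use that r0 in auto)
  have "f integrable_on {r..t}"
    using r0 by (auto intro: integrable_subinterval_real[OF f])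
  \<comment> \<open>The hypothesis does not control the sign of \<open>f r\<close>, so the value at
    this single point is replaced.\<close>
  then have "((\<lambda>s. if s = r then 0 else f s) has_integral integral {r..t} f) {r..t}"
    by (intro has_integral_spike_finite[OF _ _ integrable_integral, of "{r}"]) auto
  then have "integral {r..t} f \<le> 0"
    by (rule has_integral_le[OF _ has_integral_0]) (use after in auto)
  moreover have "F r + integral {r..t} f = F t"
    unfolding F_def using r0 f by (intro Henstock_Kurzweil_Integration.integral_combine) auto
  ultimately show False using r0 Ft by simp
qed

text \<open>Both solutions share the same nonnegative \<open>w\<close>, and
  \<open>exp (- (k * A))\<close> decreases in \<open>A\<close>.\<close>

lemma coagulation_le:
  assumes "coagulation lam v0 v" "coagulation lam' v0 v'" "0 \<le> t"
    and "coagulation.A lam v t \<le> coagulation.A lam' v' t"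
  shows "v' t (Suc k) \<le> v t (Suc k)" "m0 (v' t) \<le> m0 (v t)"
proof -
  interpret a: coagulation lam v0 v by fact
  interpret b: coagulation lam' v0 v' by fact
  show le: "v' t (Suc k) \<le> v t (Suc k)" for k
  proof -
    have "a.w (Suc k) t = b.w (Suc k) t"
      using assms by (intro coagulation_w_unique) auto
    moreover have "exp (- (real (Suc k) * b.A t)) \<le> exp (- (real (Suc k) * a.A t))"
      using assms by simp
    ultimately show ?thesis
      unfolding a.v_eq_w[of t "Suc k"] b.v_eq_w[of t "Suc k"]
      using b.w_nonneg[OF \<open>0 \<le> t\<close>, of k] by (simp only: mult_right_mono)
  qed
  show "m0 (v' t) \<le> m0 (v t)"
    unfolding m0_def using assms by (intro suminf_le le inN_summable a.inN_v b.inN_v)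
qed

text \<open>A feedback argument: while a claimed bound fails, \<open>coagulation_le\<close> orders
  the masses so that the violation cannot grow. For the second bound, a violation implies that the
  subcritical \<open>A\<close> is the larger one because \<open>lam\<close> is nonnegative.\<close>

lemma coagulation_A_bounds:
  assumes "coagulation (\<lambda>_. 0) v0 v" "coagulation lam v0 v'"
    and lam: "\<And>s. 0 \<le> s \<Longrightarrow> 0 \<le> lam s" and t: "0 \<le> t"
  shows "coagulation.A (\<lambda>_. 0) v t \<le> coagulation.A lam v' t"
    and "coagulation.A lam v' t \<le> coagulation.A (\<lambda>_. 0) v t + integral {0..t} lam"
proof -
  interpret a: coagulation "\<lambda>_. 0" v0 v by fact
  interpret b: coagulation lam v0 v' by fact
  have int1: "integral {0..s} (\<lambda>s. m0 (v s) - (m0 (v' s) + lam s)) = a.A s - b.A s" for s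
    unfolding a.A_def b.A_def
    by (subst integral_diff) (auto intro: a.mass_integrable integrable_add b.mass_integrable b.lam_integrable)
  have int2: "integral {0..s} (\<lambda>s. m0 (v' s) - m0 (v s)) = b.A s - a.A s - integral {0..s} lam" for s
    unfolding a.A_eq b.A_eq
    by (subst integral_diff) (auto intro: a.mass_integrable b.mass_integrable)
  have "integral {0..t} (\<lambda>s. m0 (v s) - (m0 (v' s) + lam s)) \<le> 0"
  proof (rule integral_nonpos_if_nonpos_when_pos)
    fix s assume s: "s \<in> {0..t}" "0 < integral {0..s} (\<lambda>s. m0 (v s) - (m0 (v' s) + lam s))"
    then have "m0 (v s) \<le> m0 (v' s)"
      by (intro coagulation_le(2)[OF assms(2,1)]) (auto simp: int1)
    then show "m0 (v s) - (m0 (v' s) + lam s) \<le> 0" using lam[of s] s by simp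
  qed (intro integrable_diff integrable_add a.mass_integrable b.mass_integrable b.lam_integrable)
  then show "a.A t \<le> b.A t" by (simp add: int1)
  have "integral {0..t} (\<lambda>s. m0 (v' s) - m0 (v s)) \<le> 0"
  proof (rule integral_nonpos_if_nonpos_when_pos)
    fix s assume s: "s \<in> {0..t}" "0 < integral {0..s} (\<lambda>s. m0 (v' s) - m0 (v s))"
    have "0 \<le> integral {0..s} lam"
      using lam by (intro Henstock_Kurzweil_Integration.integral_nonneg b.lam_integrable) auto
    with s have "m0 (v' s) \<le> m0 (v s)"
      by (intro coagulation_le(2)[OF assms(1,2)]) (auto simp: int2)
    then show "m0 (v' s) - m0 (v s) \<le> 0" by simp
  qed (intro integrable_diff a.mass_integrable b.mass_integrable)
  then show "b.A t \<le> a.A t + integral {0..t} lam" by (simp add: int2)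
qed

text \<open>Polya's argument: monotonicity controls the functions between finitely many grid points.\<close>

lemma uniform_limit_antimono:
  fixes f :: "nat \<Rightarrow> real \<Rightarrow> real" and g :: "real \<Rightarrow> real"
  assumes anti: "\<And>n s t. N \<le> n \<Longrightarrow> 0 \<le> s \<Longrightarrow> s \<le> t \<Longrightarrow> f n t \<le> f n s"
    and bounds: "\<And>n t. N \<le> n \<Longrightarrow> 0 \<le> t \<Longrightarrow> 0 \<le> f n t" "\<And>n t. N \<le> n \<Longrightarrow> 0 \<le> t \<Longrightarrow> f n t \<le> g t"
    and lim: "\<And>t. 0 \<le> t \<Longrightarrow> (\<lambda>n. f n t) \<longlonglongrightarrow> g t"
    and g: "continuous_on {0..} g" "\<And>s t. 0 \<le> s \<Longrightarrow> s \<le> t \<Longrightarrow> g t \<le> g s"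
    and g0: "\<And>e. 0 < e \<Longrightarrow> \<exists>t\<ge>0. g t < e"
  shows "uniform_limit {0..} f g sequentially"
proof (rule uniform_limitI)
  fix e :: real assume e: "0 < e"
  obtain T0 where "0 \<le> T0" "g T0 < e" using g0[OF e] by blast
  then obtain T where T: "0 < T" "g T < e"
    using g(2)[of T0 "T0 + 1"] by (intro that[of "T0 + 1"]) auto
  have "uniformly_continuous_on {0..T} g"
    by (intro compact_uniformly_continuous continuous_on_subset[OF g(1)]) auto
  then obtain d where d: "0 < d"
    "\<And>s t. s \<in> {0..T} \<Longrightarrow> t \<in> {0..T} \<Longrightarrow> dist s t < d \<Longrightarrow> dist (g s) (g t) < e / 2"
    unfolding uniformly_continuous_on_def using e by (meson half_gt_zero)
  define h where "h = d / 2"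
  have h: "0 < h" "h < d" using d by (auto simp: h_def)
  define K where "K = nat \<lceil>T / h\<rceil>"
  \<comment> \<open>Grid points of mesh \<open>h < d\<close>, capped at \<open>T\<close>; pointwise
    convergence is uniform on these finitely many points.\<close>
  have "\<forall>\<^sub>F n in sequentially. \<forall>i\<in>{..K}. dist (f n (min T (real i * h))) (g (min T (real i * h))) < e / 2"
    using T h e by (intro eventually_ball_finite ballI tendstoD lim) auto
  moreover have "\<forall>\<^sub>F n in sequentially. N \<le> n" by (rule eventually_ge_at_top)
  ultimately show "\<forall>\<^sub>F n in sequentially. \<forall>t\<in>{0..}. dist (f n t) (g t) < e"
  proof eventually_elim
    case (elim n)
    show ?case
    proof
      fix t :: real assume "t \<in> {0..}"
      then have t: "0 \<le> t" by simp
      have "g t - f n t < e"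
      proof (cases "t < T")
        case False
        \<comment> \<open>Beyond \<open>T\<close> both functions lie between 0 and
          \<open>g T < e\<close>.\<close>
        then show ?thesis using bounds(1)[OF elim(2) t] g(2)[of T t] T by simp
      next
        case True
        define i where "i = nat \<lfloor>t / h\<rfloor>"
        \<comment> \<open>The next grid point after \<open>t\<close>. Then
          \<open>g t - f n t \<le> (g t - g s) + (g s - f n s)\<close>, each bracket being below
          \<open>e / 2\<close>.\<close>
        define s where "s = min T (real (Suc i) * h)"
        have i: "real i \<le> t / h" "t / h < real i + 1"
          using t h by (auto simp: i_def)
        then have ih: "real i * h \<le> t" "t < real (Suc i) * h"
          using h by (simp_all add: field_simps)
        have s: "t < s" "s \<le> T" "s - t < d" using ih True h by (auto simp: s_def algebra_simps)
        have "t / h < T / h" using True h by (simp add: divide_strict_right_mono)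
        then have "real i < real_of_int \<lceil>T / h\<rceil>" using i le_of_int_ceiling[of "T / h"] by linarith
        then have "Suc i \<le> K" by (simp add: K_def)
        then have "dist (f n s) (g s) < e / 2" using elim(1) unfolding s_def by blast
        moreover have "dist (g t) (g s) < e / 2"
          using s t True by (intro d) (auto simp: dist_real_def)
        moreover have "f n s \<le> f n t" using s t by (intro anti elim) auto
        ultimately show ?thesis by (simp add: dist_real_def abs_if split: if_splits)
      qed
      then show "dist (f n t) (g t) < e"
        using bounds(2)[OF elim(2) t] by (simp add: dist_real_def)
    qed
  qed
qed

section \<open>Convergence\<close>

theorem theorem3:
  fixes v0 :: "nat \<Rightarrow> real"
    and lam :: "nat \<Rightarrow> real \<Rightarrow> real"
    and vn :: "nat \<Rightarrow> real \<Rightarrow> nat \<Rightarrow> real"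
    and v :: "real \<Rightarrow> nat \<Rightarrow> real"
  assumes v0: "inNstar v0"
    and lam_cont: "\<And>n. n \<ge> 1 \<Longrightarrow> continuous_on {0..} (lam n)"
    and lam_pos: "\<And>n t. n \<ge> 1 \<Longrightarrow> t \<ge> 0 \<Longrightarrow> lam n t > 0"
    and lam_inf: "\<And>n. n \<ge> 1 \<Longrightarrow> \<exists>c>0. \<forall>t\<ge>0. lam n t \<ge> c"
    and lam_unif: "uniform_limit {0..} lam (\<lambda>_. 0) sequentially"
    and vn_sol: "\<And>n. n \<ge> 1 \<Longrightarrow> coag_sol (lam n) v0 (vn n)"
    and v_sol: "coag_sol (\<lambda>_. 0) v0 v"
  shows "(\<forall>t\<ge>0. \<forall>k\<ge>1. (\<lambda>n. vn n t k) \<longlonglongrightarrow> v t k)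
    \<and> uniform_limit {0..} (\<lambda>n t. m0 v0 - m0 (vn n t)) (\<lambda>t. m0 v0 - m0 (v t)) sequentially"
proof -
  have sol: "coagulation (\<lambda>_. 0) v0 v"
    using v_sol by (intro coagulation.intro) auto
  have soln: "coagulation (lam n) v0 (vn n)" if "1 \<le> n" for n
    using vn_sol[OF that] lam_cont[OF that] by (intro coagulation.intro)
  interpret c: coagulation "\<lambda>_. 0" v0 v by (rule sol)
  define An where "An = (\<lambda>n. coagulation.A (lam n) (vn n))"
  have lam_nonneg: "0 \<le> lam n s" if "1 \<le> n" "0 \<le> s" for n s
    using lam_pos[OF that] by simp
  have A_le: "c.A t \<le> An n t" if "1 \<le> n" "0 \<le> t" for n t
    unfolding An_def using that lam_nonneg by (intro coagulation_A_bounds(1)[OF sol soln]) auto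
  have A_lim: "(\<lambda>n. An n t) \<longlonglongrightarrow> c.A t" if t: "0 \<le> t" for t
  proof (rule LIMSEQ_I)
    fix e :: real assume e: "0 < e"
    \<comment> \<open>Ensures \<open>t * d < e\<close>, also for \<open>t = 0\<close>.\<close>
    define d where "d = e / (t + 1)"
    have d: "0 < d" "t * d < e" using t e by (simp_all add: d_def field_simps)
    obtain N where N: "\<And>n s. N \<le> n \<Longrightarrow> 0 \<le> s \<Longrightarrow> \<bar>lam n s\<bar> < d"
      using uniform_limitD[OF lam_unif d(1)] by (auto simp: eventually_sequentially)
    show "\<exists>N. \<forall>n\<ge>N. norm (An n t - c.A t) < e"
    proof (intro exI[of _ "max N 1"] allI impI)
      fix n assume "max N 1 \<le> n"
      then have n: "N \<le> n" "1 \<le> n" by auto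
      interpret b: coagulation "lam n" v0 "vn n" by (rule soln[OF n(2)])
      have "An n t \<le> c.A t + integral {0..t} (lam n)"
        unfolding An_def using n t lam_nonneg by (intro coagulation_A_bounds(2)[OF sol soln]) auto
      moreover have "integral {0..t} (lam n) \<le> integral {0..t} (\<lambda>_. d)"
        using N[OF n(1)] by (intro integral_le b.lam_integrable) (auto simp: abs_less_iff intro: less_imp_le)
      ultimately show "norm (An n t - c.A t) < e"
        using A_le[OF n(2) t] d t by simp
    qed
  qed
  have v_le: "vn n t (Suc k) \<le> v t (Suc k)" "m0 (vn n t) \<le> m0 (v t)" if "1 \<le> n" "0 \<le> t" for n t k
    using coagulation_le[OF sol soln[OF that(1)] that(2)] A_le[OF that] by (simp_all add: An_def)
  have v_lim: "(\<lambda>n. vn n t k) \<longlonglongrightarrow> v t k" if t: "0 \<le> t" and k: "1 \<le> k" for t k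
  proof -
    \<comment> \<open>The factor \<open>c.w k t\<close> is the same for all \<open>n\<close>, so
      only \<open>An n t\<close> has to converge.\<close>
    have "vn n t k = exp (- (real k * An n t)) * c.w k t" if "1 \<le> n" for n
      unfolding coagulation_w_unique[OF sol soln[OF that] k t] An_def
      by (rule coagulation.v_eq_w[OF soln[OF that]])
    then have "\<forall>\<^sub>F n in sequentially. exp (- (real k * An n t)) * c.w k t = vn n t k"
      by (intro eventually_sequentiallyI[of 1]) simp
    moreover have "(\<lambda>n. exp (- (real k * An n t)) * c.w k t) \<longlonglongrightarrow> v t k"
      unfolding c.v_eq_w[of t k] by (intro tendsto_intros A_lim t)
    ultimately show ?thesis by (rule Lim_transform_eventually[rotated])
  qed
  have mass_lim: "(\<lambda>n. m0 (vn n t)) \<longlonglongrightarrow> m0 (v t)" if t: "0 \<le> t" for t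
  \<comment> \<open>Below the limit, a finite partial sum already exceeds \<open>a\<close> and
    converges; above it, the subcritical mass is dominated by the critical one.\<close>
  proof (rule order_tendstoI)
    fix a assume "a < m0 (v t)"
    then obtain j where j: "a < (\<Sum>k<j. v t (Suc k))"
      using m0_le[OF c.inN_v[OF t], of a] by (force simp: not_le[symmetric])
    have "(\<lambda>n. \<Sum>k<j. vn n t (Suc k)) \<longlonglongrightarrow> (\<Sum>k<j. v t (Suc k))"
      by (intro tendsto_sum v_lim t) auto
    from order_tendstoD(1)[OF this j] eventually_ge_at_top[of 1]
    show "\<forall>\<^sub>F n in sequentially. a < m0 (vn n t)"
    proof eventually_elim
      case (elim n)
      then show ?case using sum_le_m0[OF coagulation.inN_v[OF soln t], of n j] by simp
    qed
  next
    fix a assume "m0 (v t) < a"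
    then show "\<forall>\<^sub>F n in sequentially. m0 (vn n t) < a"
      using v_le(2)[OF _ t] by (intro eventually_sequentiallyI[of 1]) (rule le_less_trans)
  qed
  have "uniform_limit {0..} (\<lambda>n t. m0 (vn n t)) (\<lambda>t. m0 (v t)) sequentially"
  proof (rule uniform_limit_antimono[where N = 1])
    show "m0 (vn n t) \<le> m0 (vn n s)" if "1 \<le> n" "0 \<le> s" "s \<le> t" for n s t
      using that by (intro coagulation.mass_antimono[OF soln])
    show "0 \<le> m0 (vn n t)" if "1 \<le> n" "0 \<le> t" for n t
      using that by (intro coagulation.mass_nonneg[OF soln])
    show "\<exists>t\<ge>0. m0 (v t) < e" if "0 < e" for e
      using that by (intro c.mass_arbitrarily_small) simp
  qed (use v_le(2) mass_lim c.continuous_on_mass c.mass_antimono in simp_all)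
  then have "uniform_limit {0..} (\<lambda>n t. m0 v0 - m0 (vn n t)) (\<lambda>t. m0 v0 - m0 (v t)) sequentially"
    by (intro uniform_limit_intros)
  then show ?thesis using v_lim by blast
qed

end
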